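(* For all integers $n\ge 1$ and $\ell\ge 1$, $$\sum_{k=1}^n c(n,k)\,A(k,\ell)=n^{\ell-1}\,n!,$$ where $c(n,k)$ denotes the number of tree-like tableaux of size $n$ with exactly $k$ points in their first row, and $A(k,\ell)$ denotes the number of non-ambiguous trees with exactly $\ell$ rows and exactly $k$ columns.
   Context: A tree-like tableau of size $n$ is a Ferrers diagram (left-justified rows of boxes, of weakly decreasing lengths from top to bottom) with $n$ of its boxes dotted (containing a point), such that: (1) the top-left box is dotted (the root); (2) for every non-root dotted box, exactly one of the following holds: there is a dotted box above it in the same column; there is a dotted box to its left in the same row; (3) every row and every column of the diagram contains at least one dotted box. The first row is the top row. A non-ambiguous tree may be viewed as a tree-like tableau whose Ferrers diagram is a rectangle. Equivalently, it is a finite set $A\subset\mathbb{N}\times\mathbb{N}$ ($\mathbb{N}=\{0,1,\dots\}$, $p=(X(p),Y(p))$) such that $(0,0)\in A$; each non-root $p\in A$ satisfies exactly one of the conditions "there is $q\in A$ with $X(q)=X(p)$, $Y(q)<Y(p)$" and "there is $r\in A$ with $Y(r)=Y(p)$, $X(r)<X(p)$"; and if some $p\in A$ has $X(p)=x$ (resp. $Y(p)=y$) then each $0\le x'<x$ (resp. $0\le y'<y$) is the $X$- (resp. $Y$-) coordinate of some point of $A$. The number of rows is the number of distinct $X$-coordinates of points of $A$ and the number of columns is the number of distinct $Y$-coordinates; a non-ambiguous tree with $\ell$ rows and $k$ columns has $k+\ell-1$ points. *)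

theory Defs
  imports Complex_Main
begin

text \<open>
  Boxes and points are pairs \<open>(i, j)\<close>, where \<open>i\<close> is the row, counted from the
  top, and \<open>j\<close> is the column, counted from the left, both starting at 0.
\<close>

definition ferrers_diagram :: "nat list \<Rightarrow> (nat \<times> nat) set" where
  "ferrers_diagram rs = {(i, j). i < length rs \<and> j < rs ! i}"

definition is_ferrers_diagram :: "(nat \<times> nat) set \<Rightarrow> bool" where
  "is_ferrers_diagram F \<longleftrightarrow> (\<exists>rs. sorted_wrt (\<ge>) rs \<and> F = ferrers_diagram rs)"

text \<open>
  \<open>F\<close> is the set of all boxes and \<open>D\<close> the set of dotted ones. The inequality
  between the two propositions below is an exclusive or.
\<close>

definition tree_like_tableau :: "(nat \<times> nat) set \<times> (nat \<times> nat) set \<Rightarrow> bool" where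
  "tree_like_tableau = (\<lambda>(F, D).
     is_ferrers_diagram F \<and> D \<subseteq> F \<and>
     (0, 0) \<in> D \<and>
     (\<forall>(i, j) \<in> D - {(0, 0)}.
        (\<exists>i' < i. (i', j) \<in> D) \<noteq> (\<exists>j' < j. (i, j') \<in> D)) \<and>
     (\<forall>(i, j) \<in> F. (\<exists>j'. (i, j') \<in> D) \<and> (\<exists>i'. (i', j) \<in> D)))"

definition tlt_count :: "nat \<Rightarrow> nat \<Rightarrow> nat" where
  "tlt_count n k =
     card {(F, D). tree_like_tableau (F, D) \<and> card D = n \<and> card {p \<in> D. fst p = 0} = k}"

definition non_ambiguous_tree :: "(nat \<times> nat) set \<Rightarrow> bool" where
  "non_ambiguous_tree A \<longleftrightarrow>
     finite A \<and>
     (0, 0) \<in> A \<and>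
     (\<forall>p \<in> A - {(0, 0)}.
        (\<exists>q \<in> A. fst q = fst p \<and> snd q < snd p) \<noteq>
        (\<exists>r \<in> A. snd r = snd p \<and> fst r < fst p)) \<and>
     (\<forall>p \<in> A. \<forall>x < fst p. \<exists>q \<in> A. fst q = x) \<and>
     (\<forall>p \<in> A. \<forall>y < snd p. \<exists>q \<in> A. snd q = y)"

text \<open>\<open>nat_count k l\<close> counts the trees with \<open>k\<close> columns and \<open>l\<close> rows, in this order.\<close>

definition nat_count :: "nat \<Rightarrow> nat \<Rightarrow> nat" where
  "nat_count k l = card {A. non_ambiguous_tree A \<and> card (fst ` A) = l \<and> card (snd ` A) = k}"


text \<open>The counted sets are finite, so the cardinalities above are genuine.\<close>

lemma finite_ferrers_diagram: "finite (ferrers_diagram rs)"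
proof -
  have "ferrers_diagram rs = (SIGMA i:{..<length rs}. {..<rs ! i})"
    by (auto simp: ferrers_diagram_def)
  then show ?thesis by simp
qed

lemma down_closed_less_card:
  fixes S :: "nat set"
  assumes "finite S" "x \<in> S" "\<And>y. y < x \<Longrightarrow> y \<in> S"
  shows "x < card S"
proof -
  have "{..x} \<subseteq> S" using assms by (auto simp: le_less)
  from card_mono[OF assms(1) this] show ?thesis by simp
qed

lemma finite_nat_count_set:
  "finite {A. non_ambiguous_tree A \<and> card (fst ` A) = l \<and> card (snd ` A) = k}"
proof (rule finite_subset)
  have *: "x < card (fst ` A) \<and> y < card (snd ` A)"
    if A: "non_ambiguous_tree A" and xy: "(x, y) \<in> A" for A x y
  proof
    have fin: "finite (fst ` A)" "finite (snd ` A)"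
      and X: "\<forall>p \<in> A. \<forall>x < fst p. \<exists>q \<in> A. fst q = x"
      and Y: "\<forall>p \<in> A. \<forall>y < snd p. \<exists>q \<in> A. snd q = y"
      using A by (simp_all add: non_ambiguous_tree_def)
    show "x < card (fst ` A)"
      using bspec[OF X xy] imageI[OF xy, of fst] by (intro down_closed_less_card fin) auto
    show "y < card (snd ` A)"
      using bspec[OF Y xy] imageI[OF xy, of snd] by (intro down_closed_less_card fin) auto
  qed
  show "{A. non_ambiguous_tree A \<and> card (fst ` A) = l \<and> card (snd ` A) = k}
      \<subseteq> Pow ({..<l} \<times> {..<k})"
    by (auto dest: *)
qed simp

lemma ferrers_diagram_down_closed:
  assumes "is_ferrers_diagram F" "(i, j) \<in> F" "i' \<le> i" "j' \<le> j"
  shows "(i', j') \<in> F"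
proof -
  obtain rs where rs: "sorted_wrt (\<ge>) rs" "F = ferrers_diagram rs"
    using assms(1) by (auto simp: is_ferrers_diagram_def)
  have ij: "i < length rs" "j < rs ! i"
    using assms(2) by (auto simp: rs(2) ferrers_diagram_def)
  have "rs ! i \<le> rs ! i'"
    using sorted_wrt_nth_less[OF rs(1), of i' i] ij(1) assms(3) by (cases "i' = i") auto
  then show ?thesis
    using ij assms(3,4) by (simp add: rs(2) ferrers_diagram_def)
qed

lemma finite_tlt_count_set:
  "finite {(F, D). tree_like_tableau (F, D) \<and> card D = n \<and> card {p \<in> D. fst p = 0} = k}"
proof (rule finite_subset)
  have *: "F \<subseteq> {..<card D} \<times> {..<card D} \<and> D \<subseteq> F" if t: "tree_like_tableau (F, D)" for F D
  proof -
    have F: "is_ferrers_diagram F" and D: "D \<subseteq> F"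
      and cov: "\<forall>(i, j) \<in> F. (\<exists>j'. (i, j') \<in> D) \<and> (\<exists>i'. (i', j) \<in> D)"
      using t by (simp_all add: tree_like_tableau_def)
    have occ: "i \<in> fst ` D" "j \<in> snd ` D" if "(i, j) \<in> F" for i j
    proof -
      obtain i' j' where "(i, j') \<in> D" "(i', j) \<in> D" using cov \<open>(i, j) \<in> F\<close> by blast
      from imageI[OF this(1), of fst] imageI[OF this(2), of snd]
      show "i \<in> fst ` D" "j \<in> snd ` D" by simp_all
    qed
    have "finite F"
      using F finite_ferrers_diagram unfolding is_ferrers_diagram_def by blast
    then have fin: "finite D" using D by (rule rev_finite_subset)
    have "i < card D \<and> j < card D" if ij: "(i, j) \<in> F" for i j
    proof -
      have "i < card (fst ` D)"
      proof (rule down_closed_less_card)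
        show "y \<in> fst ` D" if "y < i" for y
          using that by (intro occ(1)[OF ferrers_diagram_down_closed[OF F ij, of y j]]) simp_all
      qed (simp_all add: fin occ(1)[OF ij])
      moreover have "j < card (snd ` D)"
      proof (rule down_closed_less_card)
        show "y \<in> snd ` D" if "y < j" for y
          using that by (intro occ(2)[OF ferrers_diagram_down_closed[OF F ij, of i y]]) simp_all
      qed (simp_all add: fin occ(2)[OF ij])
      ultimately show ?thesis
        using card_image_le[OF fin, of fst] card_image_le[OF fin, of snd] by linarith
    qed
    then show ?thesis using D by auto
  qed
  show "{(F, D). tree_like_tableau (F, D) \<and> card D = n \<and> card {p \<in> D. fst p = 0} = k}
      \<subseteq> Pow ({..<n} \<times> {..<n}) \<times> Pow ({..<n} \<times> {..<n})"
  proof (rule subsetI, elim CollectE case_prodE conjE)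
    fix x F D
    assume "x = (F, D)" "tree_like_tableau (F, D)" "card D = n"
    with *[of F D] show "x \<in> Pow ({..<n} \<times> {..<n}) \<times> Pow ({..<n} \<times> {..<n})"
      by blast
  qed
qed simp

end

(* Build a tableau along its boundary from the top right to the bottom left. A dot with a dot
   above it must be the leftmost one of its row, so at each stage a row is either closed or
   "live"; adding a column at the left means choosing a nonempty set S of live rows, of which all
   but the topmost become closed. The leftmost column consists of exactly the live rows.
   Adding an empty row may be regarded as the choice S = {}.

   Let B k t be the sum of t^g over the fillings of the l x k rectangle, where g is the number of
   live rows other than the first one. Summing over S gives
     B (k + 1) t + t * B k t = (t + 1) * B k (t + 1),
   and A(k + 1, l) = B k 1. Weight a partial tableau having g such live rows and k dots in its
   first row by t^g * B k t. The same sum over S, now including S = {}, turns the total weight W N t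
   of the partial tableaux with N + 1 boundary edges into (t + 1) * W (N - 1) (t + 1), whence
   t! * W N t = (t + N)! * B 0 (t + N), where B 0 t = t^(l - 1). The theorem is the case t = 1,
   N = n - 1. *)

theory Submission
  imports Defs
begin

section \<open>Adding a column at the left\<close>

definition add_column :: "nat set \<Rightarrow> (nat \<times> nat) set \<Rightarrow> (nat \<times> nat) set" where
  "add_column S D = (\<lambda>i. (i, 0)) ` S \<union> map_prod id Suc ` D"

lemma mem_add_column_0 [simp]: "(i, 0) \<in> add_column S D \<longleftrightarrow> i \<in> S"
  by (auto simp: add_column_def)

lemma mem_add_column_Suc [simp]: "(i, Suc j) \<in> add_column S D \<longleftrightarrow> (i, j) \<in> D"
  by (force simp: add_column_def)

lemma add_column_eq_iff [simp]: "add_column S D = add_column S' D' \<longleftrightarrow> S = S' \<and> D = D'"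
proof
  assume *: "add_column S D = add_column S' D'"
  have "i \<in> S \<longleftrightarrow> i \<in> S'" for i
    using mem_add_column_0 * by metis
  moreover have "(i, j) \<in> D \<longleftrightarrow> (i, j) \<in> D'" for i j
    using mem_add_column_Suc * by metis
  ultimately show "S = S' \<and> D = D'"
    by auto
qed simp

lemma add_column_split: "add_column {i. (i, 0) \<in> X} {(i, j). (i, Suc j) \<in> X} = X"
proof -
  have "(i, j) \<in> add_column {i. (i, 0) \<in> X} {(i, j). (i, Suc j) \<in> X} \<longleftrightarrow> (i, j) \<in> X" for i j
    by (cases j) auto
  then show ?thesis by auto
qed

lemma add_column_mono_iff: "add_column S D \<subseteq> add_column S' D' \<longleftrightarrow> S \<subseteq> S' \<and> D \<subseteq> D'"
proof
  assume *: "add_column S D \<subseteq> add_column S' D'"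
  have "i \<in> S \<Longrightarrow> i \<in> S'" for i
    using mem_add_column_0 * by (metis subsetD)
  moreover have "(i, j) \<in> D \<Longrightarrow> (i, j) \<in> D'" for i j
    using mem_add_column_Suc * by (metis subsetD)
  ultimately show "S \<subseteq> S' \<and> D \<subseteq> D'"
    by auto
qed (auto simp: add_column_def)

lemma add_column_rectangle: "add_column {..<r} ({..<r} \<times> {..<c}) = {..<r} \<times> {..<Suc c}"
proof -
  have "(i, j) \<in> add_column {..<r} ({..<r} \<times> {..<c}) \<longleftrightarrow> (i, j) \<in> {..<r} \<times> {..<Suc c}" for i j
    by (cases j) auto
  then show ?thesis by auto
qed

lemma add_column_subset_rectangle:
  "add_column S D \<subseteq> {..<r} \<times> {..<Suc c} \<longleftrightarrow> S \<subseteq> {..<r} \<and> D \<subseteq> {..<r} \<times> {..<c}"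
  unfolding add_column_rectangle [symmetric] add_column_mono_iff ..

lemma card_add_column:
  assumes "finite S" "finite D"
  shows "card (add_column S D) = card S + card D"
proof -
  have "card (add_column S D) = card ((\<lambda>i. (i, 0::nat)) ` S) + card (map_prod id Suc ` D)"
    unfolding add_column_def by (rule card_Un_disjoint) (use assms in auto)
  also have "card ((\<lambda>i. (i, 0::nat)) ` S) = card S"
    by (rule card_image) (auto intro: inj_onI)
  also have "card (map_prod id Suc ` D) = card D"
    by (rule card_image) (auto intro: inj_onI)
  finally show ?thesis .
qed

abbreviation first_row :: "(nat \<times> nat) set \<Rightarrow> (nat \<times> nat) set" where
  "first_row D \<equiv> {p \<in> D. fst p = 0}"

lemma card_first_row_add_column:
  assumes "finite D"
  shows "card (first_row (add_column S D)) = (if 0 \<in> S then 1 else 0) + card (first_row D)"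
proof -
  have "first_row (add_column S D) = add_column (S \<inter> {0}) (first_row D)"
    by (auto simp: add_column_def)
  moreover have "card (S \<inter> {0}) = (if 0 \<in> S then 1 else 0)"
    by simp
  ultimately show ?thesis
    using assms by (simp add: card_add_column)
qed

section \<open>Partial fillings of rectangles and their live rows\<close>

definition above :: "(nat \<times> nat) set \<Rightarrow> nat \<Rightarrow> nat \<Rightarrow> bool" where
  "above D i j \<longleftrightarrow> (\<exists>i'<i. (i', j) \<in> D)"

lemma above_add_column_0 [simp]: "above (add_column S D) i 0 \<longleftrightarrow> (\<exists>i'<i. i' \<in> S)"
  by (simp add: above_def)

lemma above_add_column_Suc [simp]: "above (add_column S D) i (Suc j) \<longleftrightarrow> above D i j"
  by (simp add: above_def)

text \<open>
  What remains of a rectangular tableau after removal of its leftmost columns: a dot without a dot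
  above it may still get its dot to the left later, and rows may still be empty.
\<close>

definition partial_filling :: "nat \<Rightarrow> nat \<Rightarrow> (nat \<times> nat) set \<Rightarrow> bool" where
  "partial_filling r c D \<longleftrightarrow>
     D \<subseteq> {..<r} \<times> {..<c} \<and> (\<forall>j<c. \<exists>i. (i, j) \<in> D) \<and>
     (\<forall>i j. (i, j) \<in> D \<longrightarrow> above D i j \<longrightarrow> (\<forall>j'<j. (i, j') \<notin> D))"

text \<open>Only live rows can receive further dots when columns are added at the left.\<close>

definition live_rows :: "nat \<Rightarrow> (nat \<times> nat) set \<Rightarrow> nat set" where
  "live_rows r D = {i. i < r \<and> (\<forall>j. (i, j) \<in> D \<longrightarrow> \<not> above D i j)}"

lemma finite_live_rows [simp]: "finite (live_rows r D)"
  by (simp add: live_rows_def)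

lemma zero_in_live_rows: "0 < r \<Longrightarrow> 0 \<in> live_rows r D"
  by (simp add: live_rows_def above_def)

lemma partial_filling_finite: "partial_filling r c D \<Longrightarrow> finite D"
  unfolding partial_filling_def by (meson finite_SigmaI finite_lessThan finite_subset)

lemma finite_partial_fillings: "finite {D. partial_filling r c D}"
  by (rule finite_subset [of _ "Pow ({..<r} \<times> {..<c})"]) (auto simp: partial_filling_def)

lemma all_nat_0_Suc: "(\<forall>j. P j) \<longleftrightarrow> P 0 \<and> (\<forall>j. P (Suc j))"
  by (metis not0_implies_Suc)

lemma partial_filling_0: "partial_filling r 0 D \<longleftrightarrow> D = {}"
  by (auto simp: partial_filling_def)

text \<open>A dot in column 0 has nothing at its left and imposes no condition. A dot further right
  with a dot above it must get nothing new at its left, which bars exactly the closed rows from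
  \<open>S\<close>.\<close>

lemma partial_filling_add_column:
  "partial_filling r (Suc c) (add_column S D) \<longleftrightarrow>
     partial_filling r c D \<and> S \<noteq> {} \<and> S \<subseteq> live_rows r D"
proof -
  have "(\<forall>i j. (i, j) \<in> add_column S D \<longrightarrow> above (add_column S D) i j \<longrightarrow>
          (\<forall>j'<j. (i, j') \<notin> add_column S D)) \<longleftrightarrow>
        (\<forall>i j. (i, j) \<in> D \<longrightarrow> above D i j \<longrightarrow> i \<notin> S \<and> (\<forall>j'<j. (i, j') \<notin> D))"
    by (subst (2) all_nat_0_Suc) (simp add: All_less_Suc2)
  then have "partial_filling r (Suc c) (add_column S D) \<longleftrightarrow>
      partial_filling r c D \<and> S \<noteq> {} \<and> S \<subseteq> {..<r} \<and>
      (\<forall>i j. (i, j) \<in> D \<longrightarrow> above D i j \<longrightarrow> i \<notin> S)"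
    by (auto simp: partial_filling_def add_column_subset_rectangle All_less_Suc2)
  also have "S \<subseteq> {..<r} \<and> (\<forall>i j. (i, j) \<in> D \<longrightarrow> above D i j \<longrightarrow> i \<notin> S) \<longleftrightarrow>
      S \<subseteq> live_rows r D"
    by (auto simp: live_rows_def)
  finally show ?thesis .
qed

lemma partial_fillings_Suc:
  "bij_betw (\<lambda>(D, S). add_column S D)
     (SIGMA D:{D. partial_filling r c D}. Pow (live_rows r D) - {{}})
     {D. partial_filling r (Suc c) D}"
proof (rule bij_betw_imageI)
  have "X \<in> (\<lambda>(D, S). add_column S D) `
      (SIGMA D:{D. partial_filling r c D}. Pow (live_rows r D) - {{}})"
    if X: "partial_filling r (Suc c) X" for X
  proof -
    obtain S D where "X = add_column S D"
      using add_column_split [of X] by metis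
    with X show ?thesis
      by (intro image_eqI [where x = "(D, S)"]) (auto simp: partial_filling_add_column)
  qed
  then show "(\<lambda>(D, S). add_column S D) `
      (SIGMA D:{D. partial_filling r c D}. Pow (live_rows r D) - {{}}) =
      {D. partial_filling r (Suc c) D}"
    by (auto simp: partial_filling_add_column)
qed (auto intro: inj_onI)

text \<open>Every new dot except the topmost has a new dot above it, which closes its row. Rows
  outside \<open>S\<close> receive nothing, and \<open>above\<close> does not change for older
  dots.\<close>

lemma live_rows_add_column:
  assumes "S \<subseteq> live_rows r D" "S \<noteq> {}"
  shows "live_rows r (add_column S D) = insert (Min S) (live_rows r D - S)"
proof -
  have fin: "finite S"
    using assms(1) by (rule finite_subset) simp
  have "i \<in> live_rows r (add_column S D) \<longleftrightarrow>
      i \<in> live_rows r D \<and> (i \<in> S \<longrightarrow> (\<forall>i'<i. i' \<notin> S))" for i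
    unfolding live_rows_def mem_Collect_eq by (subst all_nat_0_Suc) auto
  moreover have "(\<forall>i'<i. i' \<notin> S) \<longleftrightarrow> i = Min S" if "i \<in> S" for i
    using Min_in [OF fin assms(2)] Min_le [OF fin] that fin
    by (metis linorder_not_less nless_le)
  moreover have "Min S \<in> S"
    using fin assms(2) by simp
  ultimately show ?thesis
    using assms(1) by blast
qed

text \<open>A column given by \<open>S\<close> adds \<open>card S\<close> dots and closes
  \<open>card S - 1\<close> rows, so each column raises the sum by one. This yields the size of a
  tableau completed by a dot in each live row.\<close>

lemma card_live_rows:
  "partial_filling r c D \<Longrightarrow> card D + card (live_rows r D) = r + c"
proof (induction c arbitrary: D)
  case 0
  then show ?case
    by (simp add: partial_filling_0 live_rows_def)
next
  case (Suc c)
  define S where "S = {i. (i, 0) \<in> D}"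
  define E where "E = {(i, j). (i, Suc j) \<in> D}"
  have D: "D = add_column S E"
    by (simp add: S_def E_def add_column_split)
  have E: "partial_filling r c E" and S: "S \<noteq> {}" "S \<subseteq> live_rows r E"
    using Suc.prems by (auto simp: D partial_filling_add_column)
  have fin: "finite S"
    using S(2) by (rule finite_subset) simp
  have "card (live_rows r D) = Suc (card (live_rows r E) - card S)"
    using S fin Min_in [OF fin S(1)] by (simp add: D live_rows_add_column card_Diff_subset)
  moreover have "card S \<le> card (live_rows r E)"
    using S by (simp add: card_mono)
  moreover have "card D = card S + card E"
    using D fin partial_filling_finite [OF E] by (simp add: card_add_column)
  ultimately show ?case
    using Suc.IH [OF E] by simp
qed

section \<open>Full fillings and their forced leftmost column\<close>

text \<open>The form shared by both kinds of objects: a non-ambiguous tree fills a rectangle, a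
  tree-like tableau fills the bounding rectangle of its diagram with all dots inside the
  diagram.\<close>

definition full_filling :: "nat \<Rightarrow> nat \<Rightarrow> (nat \<times> nat) set \<Rightarrow> bool" where
  "full_filling r c D \<longleftrightarrow>
     D \<subseteq> {..<r} \<times> {..<c} \<and> (0, 0) \<in> D \<and>
     (\<forall>i j. (i, j) \<in> D \<longrightarrow> (i, j) \<noteq> (0, 0) \<longrightarrow> above D i j \<noteq> (\<exists>j'<j. (i, j') \<in> D)) \<and>
     (\<forall>i<r. \<exists>j. (i, j) \<in> D) \<and> (\<forall>j<c. \<exists>i. (i, j) \<in> D)"

text \<open>In a closed row the dot with a dot above it is leftmost, so the other dots of the row
  have it at their left; in a live row the new dot serves. Row 0 is live, so the root lies above the
  other new dots.\<close>

lemma full_filling_add_live_rows: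
  assumes "partial_filling r c D" "0 < r"
  shows "full_filling r (Suc c) (add_column (live_rows r D) D)" (is "full_filling _ _ ?A")
proof -
  have sub: "D \<subseteq> {..<r} \<times> {..<c}" and cols: "\<forall>j<c. \<exists>i. (i, j) \<in> D"
    and b: "\<And>i j j'. (i, j) \<in> D \<Longrightarrow> above D i j \<Longrightarrow> j' < j \<Longrightarrow> (i, j') \<notin> D"
    using assms(1) by (auto simp: partial_filling_def)
  have zero: "0 \<in> live_rows r D"
    using assms(2) by (rule zero_in_live_rows)
  have live: "\<exists>j. (i, j) \<in> D \<and> above D i j" if "i < r" "i \<notin> live_rows r D" for i
    using that by (auto simp: live_rows_def)
  have "above ?A i j \<noteq> (\<exists>j'<j. (i, j') \<in> ?A)" if ij: "(i, j) \<in> ?A" "(i, j) \<noteq> (0, 0)" for i j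
  proof (cases j)
    case 0
    then show ?thesis
      using that zero by auto
  next
    case (Suc k)
    then have k: "(i, k) \<in> D" and i: "i < r"
      using ij sub by auto
    show ?thesis
    proof (cases "above D i k")
      case True
      then have "i \<notin> live_rows r D"
        using k by (auto simp: live_rows_def)
      then show ?thesis
        using True b [OF k True] by (auto simp: Suc Ex_less_Suc2)
    next
      case False
      have "(\<exists>j'<k. (i, j') \<in> D) \<or> i \<in> live_rows r D"
      proof (rule disjCI)
        assume "i \<notin> live_rows r D"
        from live [OF i this] obtain j' where j': "(i, j') \<in> D" "above D i j'"
          by blast
        then have "j' \<noteq> k" "\<not> k < j'"
          using False b [OF j'] k by blast+
        then show "\<exists>j'<k. (i, j') \<in> D"
          using j' by (metis linorder_neqE_nat)
      qed
      then show ?thesis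
        using False by (auto simp: Suc Ex_less_Suc2)
    qed
  qed
  moreover have "\<exists>j. (i, j) \<in> ?A" if "i < r" for i
    using live [OF that] mem_add_column_0 mem_add_column_Suc by blast
  moreover have "\<forall>j<Suc c. \<exists>i. (i, j) \<in> ?A"
    using zero cols by (auto simp: All_less_Suc2)
  moreover have "?A \<subseteq> {..<r} \<times> {..<Suc c}"
    using sub by (auto simp: add_column_subset_rectangle live_rows_def)
  ultimately show ?thesis
    using zero unfolding full_filling_def by simp
qed

text \<open>Column 0 is forced: an empty row needs a dot, the leftmost dot of a nonempty live row
  has none above it and needs one at its left, and a dot with one above it tolerates none at its
  left.\<close>

lemma full_filling_remove_column:
  assumes "full_filling r (Suc c) (add_column S D)"
  shows "partial_filling r c D" "S = live_rows r D" "0 < r"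
proof -
  let ?A = "add_column S D"
  have sub: "S \<subseteq> {..<r}" "D \<subseteq> {..<r} \<times> {..<c}" and zero: "0 \<in> S"
    and x: "\<And>i j. (i, j) \<in> ?A \<Longrightarrow> (i, j) \<noteq> (0, 0) \<Longrightarrow> above ?A i j \<noteq> (\<exists>j'<j. (i, j') \<in> ?A)"
    and rows: "\<And>i. i < r \<Longrightarrow> \<exists>j. (i, j) \<in> ?A"
    and cols: "\<forall>j<Suc c. \<exists>i. (i, j) \<in> ?A"
    using assms by (auto simp: full_filling_def add_column_subset_rectangle)
  have xS: "above D i j \<noteq> (i \<in> S \<or> (\<exists>j'<j. (i, j') \<in> D))" if "(i, j) \<in> D" for i j
    using x [of i "Suc j"] that by (simp add: Ex_less_Suc2)
  show "partial_filling r c D"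
    using sub cols xS by (auto simp: partial_filling_def All_less_Suc2)
  show "0 < r"
    using zero sub by auto
  have "i \<in> S" if i: "i \<in> live_rows r D" for i
  proof (rule ccontr)
    assume "i \<notin> S"
    have "i < r"
      using i by (simp add: live_rows_def)
    then obtain j where "(i, j) \<in> ?A"
      using rows by blast
    with \<open>i \<notin> S\<close> have ex: "\<exists>j. (i, j) \<in> D"
      by (cases j) auto
    define j where "j = (LEAST j. (i, j) \<in> D)"
    have "(i, j) \<in> D" "\<forall>j'<j. (i, j') \<notin> D"
      using LeastI_ex [OF ex] not_less_Least by (auto simp: j_def)
    with xS [of i j] \<open>i \<notin> S\<close> i show False
      by (auto simp: live_rows_def)
  qed
  moreover have "S \<subseteq> live_rows r D"
    using sub xS by (auto simp: live_rows_def)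
  ultimately show "S = live_rows r D"
    by blast
qed

text \<open>Reduces the counting of full fillings to that of partial fillings with one column
  less.\<close>

lemma full_filling_iff:
  "full_filling r (Suc c) A \<longleftrightarrow>
     0 < r \<and> (\<exists>D. partial_filling r c D \<and> A = add_column (live_rows r D) D)"
  by (metis add_column_split full_filling_add_live_rows full_filling_remove_column)

section \<open>Weighted sums over sets of live rows\<close>

text \<open>Binomial expansion of a product of factors \<open>1 + t\<close>, where \<open>S\<close>
  is the set of factors contributing the 1.\<close>

lemma sum_power_card_Diff:
  fixes t :: nat
  assumes "finite G"
  shows "(\<Sum>S\<in>Pow G. t ^ card (G - S)) = (t + 1) ^ card G"
proof -
  have "(\<Sum>S\<in>Pow G. t ^ card (G - S)) = (\<Sum>S\<in>Pow G. (\<Prod>i\<in>S. 1) * (\<Prod>i\<in>G - S. t))"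
    by simp
  also have "\<dots> = (\<Prod>i\<in>G. 1 + t)"
    using assms by (rule prod_add [symmetric])
  finally show ?thesis by simp
qed

text \<open>
  \<open>L\<close> is the set of live rows before \<open>S\<close> is added as a new column, and
  \<open>insert (Min S) (L - S)\<close> the one afterwards. The empty set stands for a new row, which is live.
\<close>

lemma sum_Pow_live:
  fixes L :: "nat set" and t :: nat and u :: "bool \<Rightarrow> nat"
  assumes "finite L" "0 \<in> L"
  defines "G \<equiv> L - {0}"
  shows "(\<Sum>S\<in>Pow L. (if S = {} then t * t ^ card G
            else t ^ card (insert (Min S) (L - S) - {0})) * u (0 \<in> S)) =
         (u True + t * u False) * (t + 1) ^ card G" (is "sum ?f _ = _")
proof -
  have G: "finite G" "0 \<notin> G" "L = insert 0 G"
    using assms by auto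
  have "sum ?f (Pow L) = sum ?f (Pow G) + sum ?f (insert 0 ` Pow G)"
    unfolding G(3) Pow_insert using G by (intro sum.union_disjoint) auto
  also have "sum ?f (insert 0 ` Pow G) = (\<Sum>S\<in>Pow G. ?f (insert 0 S))"
    using G(2) by (intro sum.reindex [unfolded o_def] inj_onI) (metis PowD insert_ident subsetD)
  also have "\<dots> = (\<Sum>S\<in>Pow G. u True * t ^ card (G - S))"
  proof (rule sum.cong [OF refl])
    fix S assume "S \<in> Pow G"
    then have "finite S" "0 \<notin> S"
      using G finite_subset by auto
    \<comment> \<open>If the first row belongs to the chosen set, it is the one that stays live, so
      every chosen row of \<open>G\<close> is closed.\<close>
    then have "Min (insert 0 S) = 0"
      by (intro Min_eqI) auto
    moreover have "insert 0 (L - insert 0 S) - {0} = G - S"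
      using G by auto
    ultimately show "?f (insert 0 S) = u True * t ^ card (G - S)"
      by (simp only: insert_not_empty if_False insert_iff simp_thms mult.commute)
  qed
  also have "sum ?f (Pow G) = (\<Sum>S\<in>Pow G. t * u False * t ^ card (G - S))"
  proof (rule sum.cong [OF refl])
    fix S assume "S \<in> Pow G"
    then have S: "finite S" "0 \<notin> S" "S \<subseteq> G"
      using G finite_subset by auto
    show "?f S = t * u False * t ^ card (G - S)"
    proof (cases "S = {}")
      case False
      then have "Min S \<in> S"
        using S(1) by simp
      \<comment> \<open>Without the first row, \<open>Min S\<close> survives inside \<open>G\<close>
        and gives one extra factor \<open>t\<close>. The summand of the empty set has the same extra
        factor, so both cases fit one formula.\<close>
      then have "insert (Min S) (L - S) - {0} = insert (Min S) (G - S)" "Min S \<notin> G - S"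
        using G S by auto
      then show ?thesis
        using False S G by simp
    qed (use S in simp)
  qed
  finally show ?thesis
    using G(1) by (simp add: sum_distrib_left [symmetric] sum_power_card_Diff
        distrib_right del: mult_Suc mult_Suc_right)
qed

text \<open>The \<open>B k t\<close> of the opening sketch. Row 0 is left out of the exponent
  because it is live in every filling.\<close>

definition filling_weight :: "nat \<Rightarrow> nat \<Rightarrow> nat \<Rightarrow> nat" where
  "filling_weight l k t = (\<Sum>D | partial_filling l k D. t ^ card (live_rows l D - {0}))"

lemma filling_weight_0: "l \<ge> 1 \<Longrightarrow> filling_weight l 0 t = t ^ (l - 1)"
  by (simp add: filling_weight_def partial_filling_0 live_rows_def)

text \<open>The second summand on the left supplies the choice \<open>S = {}\<close>, which a
  rectangle of fixed height excludes; with it the sum runs over all subsets of the live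
  rows.\<close>

lemma filling_weight_Suc:
  assumes "l \<ge> 1"
  shows "filling_weight l (Suc k) t + t * filling_weight l k t =
         (t + 1) * filling_weight l k (t + 1)"
proof -
  let ?P = "{D. partial_filling l k D}"
  let ?g = "\<lambda>D. card (live_rows l D - {0})"
  let ?h = "\<lambda>D S. t ^ card (insert (Min S) (live_rows l D - S) - {0})"
  have "filling_weight l (Suc k) t =
      (\<Sum>(D, S)\<in>(SIGMA D:?P. Pow (live_rows l D) - {{}}). t ^ ?g (add_column S D))"
    unfolding filling_weight_def
    by (subst sum.reindex_bij_betw [OF partial_fillings_Suc, symmetric])
      (simp add: case_prod_unfold)
  also have "\<dots> = (\<Sum>D\<in>?P. \<Sum>S\<in>Pow (live_rows l D) - {{}}. t ^ ?g (add_column S D))"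
    by (rule sum.Sigma [symmetric]) (auto simp: finite_partial_fillings)
  also have "\<dots> = (\<Sum>D\<in>?P. \<Sum>S\<in>Pow (live_rows l D) - {{}}. ?h D S)"
    by (intro sum.cong) (auto simp: live_rows_add_column)
  finally have "filling_weight l (Suc k) t + t * filling_weight l k t =
      (\<Sum>D\<in>?P. t * t ^ ?g D + (\<Sum>S\<in>Pow (live_rows l D) - {{}}. ?h D S))"
    by (simp add: filling_weight_def sum.distrib sum_distrib_left)
  also have "\<dots> = (\<Sum>D\<in>?P. (t + 1) * (t + 1) ^ ?g D)"
  proof (rule sum.cong [OF refl])
    fix D
    let ?L = "live_rows l D"
    have "0 \<in> ?L"
      using assms by (intro zero_in_live_rows) simp
    \<comment> \<open>\<open>u\<close> is constantly 1 since dots of the first row carry no weight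
      here.\<close>
    from sum_Pow_live [OF _ this, of t "\<lambda>_. 1"]
    have "(\<Sum>S\<in>Pow ?L. if S = {} then t * t ^ ?g D else ?h D S) = (t + 1) * (t + 1) ^ ?g D"
      by simp
    then show "t * t ^ ?g D + (\<Sum>S\<in>Pow ?L - {{}}. ?h D S) = (t + 1) * (t + 1) ^ ?g D"
      by (subst (asm) sum.remove [of _ "{}"]) auto
  qed
  finally show ?thesis
    by (simp add: filling_weight_def sum_distrib_left)
qed

section \<open>Non-ambiguous trees as full fillings\<close>

lemma ex_left_iff: "(\<exists>q \<in> A. fst q = i \<and> snd q < j) \<longleftrightarrow> (\<exists>j'<j. (i, j') \<in> A)"
  by force

lemma ex_above_iff: "(\<exists>q \<in> A. snd q = j \<and> fst q < i) \<longleftrightarrow> above A i j"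
  unfolding above_def by force

lemma down_closed_eq_lessThan:
  fixes S :: "nat set"
  assumes "finite S" "\<And>x y. x \<in> S \<Longrightarrow> y < x \<Longrightarrow> y \<in> S"
  shows "S = {..<card S}"
proof -
  have "S \<subseteq> {..<card S}"
    using down_closed_less_card [OF assms(1)] assms(2) by blast
  then show ?thesis
    by (intro card_subset_eq) auto
qed

text \<open>The last two conditions on a tree make both coordinate projections initial segments,
  whose lengths are their cardinalities; so every row and column of the rectangle is
  occupied.\<close>

lemma non_ambiguous_tree_iff:
  "non_ambiguous_tree A \<and> card (fst ` A) = l \<and> card (snd ` A) = k \<longleftrightarrow> full_filling l k A"
proof
  assume "full_filling l k A"
  then have sub: "A \<subseteq> {..<l} \<times> {..<k}" and zero: "(0, 0) \<in> A"
    and x: "\<And>i j. (i, j) \<in> A \<Longrightarrow> (i, j) \<noteq> (0, 0) \<Longrightarrow> above A i j \<noteq> (\<exists>j'<j. (i, j') \<in> A)"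
    and rows: "\<And>i. i < l \<Longrightarrow> \<exists>j. (i, j) \<in> A"
    and cols: "\<And>j. j < k \<Longrightarrow> \<exists>i. (i, j) \<in> A"
    by (auto simp: full_filling_def)
  have fin: "finite A"
    using sub by (rule finite_subset) simp
  have "fst ` A = {..<l}" "snd ` A = {..<k}"
    using sub rows cols by force+
  moreover have "(\<exists>q \<in> A. fst q = fst p \<and> snd q < snd p) \<noteq>
      (\<exists>r \<in> A. snd r = snd p \<and> fst r < fst p)" if "p \<in> A - {(0, 0)}" for p
    using x [of "fst p" "snd p"] that unfolding ex_left_iff ex_above_iff by (cases p) auto
  moreover have "\<exists>q \<in> A. fst q = x'" if "p \<in> A" "x' < fst p" for p x'
    using rows [of x'] sub that by (cases p) force
  moreover have "\<exists>q \<in> A. snd q = y" if "p \<in> A" "y < snd p" for p y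
    using cols [of y] sub that by (cases p) force
  ultimately show "non_ambiguous_tree A \<and> card (fst ` A) = l \<and> card (snd ` A) = k"
    using fin zero by (simp add: non_ambiguous_tree_def)
next
  assume *: "non_ambiguous_tree A \<and> card (fst ` A) = l \<and> card (snd ` A) = k"
  then have fin: "finite A" and zero: "(0, 0) \<in> A"
    and x: "\<And>p. p \<in> A - {(0, 0)} \<Longrightarrow> (\<exists>q \<in> A. fst q = fst p \<and> snd q < snd p) \<noteq>
        (\<exists>r \<in> A. snd r = snd p \<and> fst r < fst p)"
    and X: "\<And>p x. p \<in> A \<Longrightarrow> x < fst p \<Longrightarrow> \<exists>q \<in> A. fst q = x"
    and Y: "\<And>p y. p \<in> A \<Longrightarrow> y < snd p \<Longrightarrow> \<exists>q \<in> A. snd q = y"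
    by (simp_all add: non_ambiguous_tree_def)
  have "fst ` A = {..<card (fst ` A)}"
    using fin X by (intro down_closed_eq_lessThan) (auto simp: image_iff, metis+)
  then have r: "fst ` A = {..<l}"
    using * by simp
  have "snd ` A = {..<card (snd ` A)}"
    using fin Y by (intro down_closed_eq_lessThan) (auto simp: image_iff, metis+)
  then have c: "snd ` A = {..<k}"
    using * by simp
  have "A \<subseteq> {..<l} \<times> {..<k}"
    unfolding r [symmetric] c [symmetric] by force
  moreover have "above A i j \<noteq> (\<exists>j'<j. (i, j') \<in> A)" if "(i, j) \<in> A" "(i, j) \<noteq> (0, 0)" for i j
    using x [of "(i, j)"] that unfolding ex_left_iff ex_above_iff by auto
  moreover have "\<exists>j. (i, j) \<in> A" if "i < l" for i
    using that r by (metis imageE lessThan_iff prod.collapse)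
  moreover have "\<exists>i. (i, j) \<in> A" if "j < k" for j
    using that c by (metis imageE lessThan_iff prod.collapse)
  ultimately show "full_filling l k A"
    using zero by (simp add: full_filling_def)
qed

text \<open>The forced leftmost column accounts for the shift from \<open>k\<close> to
  \<open>Suc k\<close>, and at \<open>t = 1\<close> each partial filling has weight 1.\<close>

lemma nat_count_Suc:
  assumes "l \<ge> 1"
  shows "nat_count (Suc k) l = filling_weight l k 1"
proof -
  have "nat_count (Suc k) l = card ((\<lambda>D. add_column (live_rows l D) D) ` {D. partial_filling l k D})"
    unfolding nat_count_def non_ambiguous_tree_iff full_filling_iff
    using assms by (intro arg_cong [where f = card]) auto
  also have "\<dots> = card {D. partial_filling l k D}"
    by (intro card_image inj_onI) simp
  finally show ?thesis
    by (simp add: filling_weight_def)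
qed

section \<open>Tree-like tableaux as full fillings inside a diagram\<close>

text \<open>Order ideals replace lists of row lengths because they pass more directly through
  \<open>add_column\<close>.\<close>

definition down_closed :: "(nat \<times> nat) set \<Rightarrow> bool" where
  "down_closed F \<longleftrightarrow> (\<forall>i j i' j'. (i, j) \<in> F \<longrightarrow> i' \<le> i \<longrightarrow> j' \<le> j \<longrightarrow> (i', j') \<in> F)"

lemma down_closedD: "down_closed F \<Longrightarrow> (i, j) \<in> F \<Longrightarrow> i' \<le> i \<Longrightarrow> j' \<le> j \<Longrightarrow> (i', j') \<in> F"
  unfolding down_closed_def by blast

lemma down_closed_add_column:
  assumes "F \<subseteq> {..<r} \<times> {..<c}"
  shows "down_closed (add_column {..<r} F) \<longleftrightarrow> down_closed F"
proof
  assume *: "down_closed (add_column {..<r} F)"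
  show "down_closed F"
    unfolding down_closed_def
    using down_closedD [OF *, of _ "Suc j" _ "Suc j'" for j j'] by simp
next
  assume *: "down_closed F"
  have "(i', j') \<in> add_column {..<r} F"
    if ij: "(i, j) \<in> add_column {..<r} F" and le: "i' \<le> i" "j' \<le> j" for i j i' j'
  proof -
    have "add_column {..<r} F \<subseteq> {..<r} \<times> {..<Suc c}"
      using assms by (simp add: add_column_subset_rectangle)
    with ij le have "i' < r" by auto
    with ij le down_closedD [OF *] show ?thesis
      by (cases j; cases j') auto
  qed
  then show "down_closed (add_column {..<r} F)"
    unfolding down_closed_def by blast
qed

lemma is_ferrers_diagram_iff:
  assumes "F \<subseteq> {..<r} \<times> {..<c}"
  shows "is_ferrers_diagram F \<longleftrightarrow> down_closed F"
proof
  assume "is_ferrers_diagram F"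
  then show "down_closed F"
    unfolding down_closed_def using ferrers_diagram_down_closed by blast
next
  assume F: "down_closed F"
  define row where "row i = {j. (i, j) \<in> F}" for i
  have fin: "finite (row i)" for i
    by (rule finite_subset [of _ "{..<c}"]) (use assms in \<open>auto simp: row_def\<close>)
  have row: "row i = {..<card (row i)}" for i
    using fin down_closedD [OF F] by (intro down_closed_eq_lessThan) (auto simp: row_def)
  \<comment> \<open>Bottom rows may have length 0; such entries contribute no boxes.\<close>
  define rs where "rs = map (\<lambda>i. card (row i)) [0..<r]"
  have "card (row i') \<le> card (row i)" if "i < i'" for i i'
    using fin down_closedD [OF F] that by (intro card_mono) (auto simp: row_def)
  then have "sorted_wrt (\<ge>) rs"
    by (simp add: rs_def sorted_wrt_iff_nth_less)
  moreover have "(i, j) \<in> F \<longleftrightarrow> i < r \<and> j < card (row i)" for i j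
  proof -
    have "(i, j) \<in> F \<longleftrightarrow> i < r \<and> j \<in> row i"
      using assms by (auto simp: row_def)
    then show ?thesis
      using row [of i] by auto
  qed
  then have "F = ferrers_diagram rs"
    by (auto simp: ferrers_diagram_def rs_def)
  ultimately show "is_ferrers_diagram F"
    unfolding is_ferrers_diagram_def by blast
qed

text \<open>The covering condition of a tableau speaks only of rows and columns that contain a box,
  so \<open>r\<close> and \<open>c\<close> are taken as the numbers of nonempty rows and columns of
  \<open>F\<close>.\<close>

lemma tree_like_tableau_iff:
  "tree_like_tableau (F, D) \<longleftrightarrow>
     (\<exists>r c. down_closed F \<and> D \<subseteq> F \<and> F \<subseteq> {..<r} \<times> {..<c} \<and> full_filling r c D)"
proof
  assume *: "tree_like_tableau (F, D)"
  then have F: "is_ferrers_diagram F" and D: "D \<subseteq> F" "(0, 0) \<in> D"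
    and xor: "\<forall>(i, j)\<in>D - {(0, 0)}. (\<exists>i'<i. (i', j) \<in> D) \<noteq> (\<exists>j'<j. (i, j') \<in> D)"
    and cov: "\<forall>(i, j)\<in>F. (\<exists>j'. (i, j') \<in> D) \<and> (\<exists>i'. (i', j) \<in> D)"
    by (simp_all add: tree_like_tableau_def)
  have x: "above D i j \<noteq> (\<exists>j'<j. (i, j') \<in> D)" if "(i, j) \<in> D" "(i, j) \<noteq> (0, 0)" for i j
    using bspec [OF xor, of "(i, j)"] that by (simp add: above_def)
  have fin: "finite F"
    using F finite_ferrers_diagram unfolding is_ferrers_diagram_def by blast
  define r c where "r = card (fst ` F)" and "c = card (snd ` F)"
  have r: "fst ` F = {..<r}"
    unfolding r_def using fin
  proof (intro down_closed_eq_lessThan)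
    fix x y assume "x \<in> fst ` F" "y < x"
    then obtain q where "(x, q) \<in> F" by force
    with \<open>y < x\<close> have "(y, q) \<in> F"
      by (intro ferrers_diagram_down_closed [OF F, of x q y q]) auto
    then show "y \<in> fst ` F"
      by (rule image_eqI [rotated]) simp
  qed simp
  have c: "snd ` F = {..<c}"
    unfolding c_def using fin
  proof (intro down_closed_eq_lessThan)
    fix x y assume "x \<in> snd ` F" "y < x"
    then obtain q where "(q, x) \<in> F" by force
    with \<open>y < x\<close> have "(q, y) \<in> F"
      by (intro ferrers_diagram_down_closed [OF F, of q x q y]) auto
    then show "y \<in> snd ` F"
      by (rule image_eqI [rotated]) simp
  qed simp
  have sub: "F \<subseteq> {..<r} \<times> {..<c}"
    unfolding r [symmetric] c [symmetric] by force
  have "\<exists>j. (i, j) \<in> D" if "i < r" for i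
  proof -
    have "i \<in> fst ` F"
      using \<open>i < r\<close> by (simp add: r)
    then obtain p where "p \<in> F" "fst p = i"
      by blast
    then show ?thesis
      using bspec [OF cov, of p] by auto
  qed
  moreover have "\<exists>i. (i, j) \<in> D" if "j < c" for j
  proof -
    have "j \<in> snd ` F"
      using \<open>j < c\<close> by (simp add: c)
    then obtain p where "p \<in> F" "snd p = j"
      by blast
    then show ?thesis
      using bspec [OF cov, of p] by auto
  qed
  ultimately have "full_filling r c D"
    using D sub x by (auto simp: full_filling_def)
  then show "\<exists>r c. down_closed F \<and> D \<subseteq> F \<and> F \<subseteq> {..<r} \<times> {..<c} \<and> full_filling r c D"
    using F D sub is_ferrers_diagram_iff [OF sub] by blast
next
  assume "\<exists>r c. down_closed F \<and> D \<subseteq> F \<and> F \<subseteq> {..<r} \<times> {..<c} \<and> full_filling r c D"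
  then obtain r c where *: "down_closed F" "D \<subseteq> F" "F \<subseteq> {..<r} \<times> {..<c}" "full_filling r c D"
    by blast
  then have "is_ferrers_diagram F"
    using is_ferrers_diagram_iff by blast
  moreover have "(\<exists>j'. (i, j') \<in> D) \<and> (\<exists>i'. (i', j) \<in> D)" if "(i, j) \<in> F" for i j
    using that * by (auto simp: full_filling_def)
  moreover have "(\<exists>i'<i. (i', j) \<in> D) \<noteq> (\<exists>j'<j. (i, j') \<in> D)"
    if "(i, j) \<in> D" "(i, j) \<noteq> (0, 0)" for i j
  proof -
    have "\<forall>i j. (i, j) \<in> D \<longrightarrow> (i, j) \<noteq> (0, 0) \<longrightarrow> above D i j \<noteq> (\<exists>j'<j. (i, j') \<in> D)"
      using *(4) unfolding full_filling_def by (elim conjE)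
    from this [rule_format, OF that] show ?thesis
      unfolding above_def .
  qed
  moreover have "(0, 0) \<in> D"
    using *(4) by (simp add: full_filling_def)
  ultimately show "tree_like_tableau (F, D)"
    using *(2) by (simp add: tree_like_tableau_def Ball_def)
qed

section \<open>Partial tableaux and their growth along the boundary\<close>

text \<open>
  Elements \<open>(r, c, F, D)\<close> have \<open>r\<close> rows, the last of which may have length 0 in the diagram \<open>F\<close>,
  and \<open>c\<close> columns, so that \<open>N = r + c\<close> is the number of boundary edges. This is also the number
  of dots of the tree-like tableau obtained by adding the leftmost column.
\<close>

definition partial_tableaux :: "nat \<Rightarrow> (nat \<times> nat \<times> (nat \<times> nat) set \<times> (nat \<times> nat) set) set" where
  "partial_tableaux N = {(r, c, F, D). 0 < r \<and> r + c = N \<and> partial_filling r c D \<and>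
     D \<subseteq> F \<and> F \<subseteq> {..<r} \<times> {..<c} \<and> down_closed F}"

lemma finite_partial_tableaux: "finite (partial_tableaux N)"
proof (rule finite_subset)
  let ?B = "{..<N} \<times> {..<N}"
  have "F \<subseteq> ?B" if "F \<subseteq> {..<r} \<times> {..<c}" "r + c = N" for F r c
    using that by fastforce
  then show "partial_tableaux N \<subseteq> {..N} \<times> {..N} \<times> Pow ?B \<times> Pow ?B"
    unfolding partial_tableaux_def by fastforce
qed simp

lemma partial_tableaux_1: "partial_tableaux (Suc 0) = {(1, 0, {}, {})}"
proof -
  have "0 < r \<and> r + c = Suc 0 \<longleftrightarrow> r = 1 \<and> c = 0" for r c :: nat
    by auto
  then show ?thesis
    by (auto simp: partial_tableaux_def partial_filling_0 down_closed_def)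
qed

lemma add_full_column_cases:
  assumes "down_closed F" "F \<subseteq> {..<r} \<times> {..<Suc c}" "\<And>i. i < r \<Longrightarrow> (i, 0) \<in> F"
  obtains F' where "F = add_column {..<r} F'" "F' \<subseteq> {..<r} \<times> {..<c}" "down_closed F'"
proof -
  obtain S F' where F: "F = add_column S F'"
    using add_column_split [of F] by metis
  have sub: "S \<subseteq> {..<r}" "F' \<subseteq> {..<r} \<times> {..<c}"
    using assms(2) by (auto simp: F add_column_subset_rectangle)
  moreover have "{..<r} \<subseteq> S"
    using assms(3) by (auto simp: F)
  ultimately have S: "S = {..<r}"
    by blast
  have "down_closed F'"
    using assms(1) down_closed_add_column [OF sub(2)] by (simp add: F S)
  then show thesis
    using that F S sub by blast
qed

text \<open>The last column spans all rows, since each row needs a dot, and is dotted in exactly the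
  live rows. The size comes from \<open>card_live_rows\<close>.\<close>

lemma tree_like_tableaux_bij:
  "bij_betw (\<lambda>(r, c, F, D). (add_column {..<r} F, add_column (live_rows r D) D))
     (partial_tableaux n) {(F, D). tree_like_tableau (F, D) \<and> card D = n}"
proof (rule bij_betw_imageI)
  let ?f = "\<lambda>(r, c, F, D). (add_column {..<r} F, add_column (live_rows r D) D)"
  \<comment> \<open>\<open>r\<close> is recovered as the height of the leftmost column of the
    diagram, and \<open>c\<close> from \<open>r + c = n\<close>.\<close>
  show "inj_on ?f (partial_tableaux n)"
    by (rule inj_onI) (auto simp: partial_tableaux_def)
  have card: "card (add_column (live_rows r D) D) = r + c" if "partial_filling r c D" for r c D
    using that card_live_rows [OF that] partial_filling_finite [OF that]
    by (simp add: card_add_column)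
  show "?f ` partial_tableaux n = {(F, D). tree_like_tableau (F, D) \<and> card D = n}"
  proof (intro equalityI subsetI)
    fix X assume "X \<in> ?f ` partial_tableaux n"
    then obtain r c F D where X: "X = (add_column {..<r} F, add_column (live_rows r D) D)"
      and *: "0 < r" "r + c = n" "partial_filling r c D" "D \<subseteq> F" "F \<subseteq> {..<r} \<times> {..<c}" "down_closed F"
      by (auto simp: partial_tableaux_def)
    have "down_closed (add_column {..<r} F)"
      using * down_closed_add_column by blast
    moreover have "add_column (live_rows r D) D \<subseteq> add_column {..<r} F"
      using * by (auto simp: add_column_mono_iff live_rows_def)
    moreover have "add_column {..<r} F \<subseteq> {..<r} \<times> {..<Suc c}"
      using * by (simp add: add_column_subset_rectangle)
    moreover have "full_filling r (Suc c) (add_column (live_rows r D) D)"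
      using * by (intro full_filling_add_live_rows)
    ultimately show "X \<in> {(F, D). tree_like_tableau (F, D) \<and> card D = n}"
      using card [OF *(3)] *(2) unfolding X tree_like_tableau_iff by blast
  next
    fix X assume "X \<in> {(F, D). tree_like_tableau (F, D) \<and> card D = n}"
    then obtain F D r k where X: "X = (F, D)" "card D = n"
      and *: "down_closed F" "D \<subseteq> F" "F \<subseteq> {..<r} \<times> {..<k}" "full_filling r k D"
      by (auto simp: tree_like_tableau_iff)
    have "k \<noteq> 0"
      using *(4) by (auto simp: full_filling_def)
    then obtain c where k: "k = Suc c"
      using not0_implies_Suc by blast
    obtain E where E: "0 < r" "partial_filling r c E" "D = add_column (live_rows r E) E"
      using *(4) by (auto simp: k full_filling_iff)
    have "(i, 0) \<in> F" if "i < r" for i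
    proof -
      have "\<exists>j. (i, j) \<in> D"
        using *(4) \<open>i < r\<close> by (simp add: full_filling_def)
      then obtain j where "(i, j) \<in> F"
        using *(2) by blast
      then show ?thesis
        using down_closedD [OF *(1)] by blast
    qed
    then obtain F' where F': "F = add_column {..<r} F'" "F' \<subseteq> {..<r} \<times> {..<c}" "down_closed F'"
      using add_full_column_cases * k by metis
    have "(r, c, F', E) \<in> partial_tableaux n"
      using E F' *(2) X(2) card [OF E(2)] by (simp add: partial_tableaux_def add_column_mono_iff)
    then show "X \<in> ?f ` partial_tableaux n"
      using X E F' by (intro image_eqI [where x = "(r, c, F', E)"]) auto
  qed
qed

text \<open>A column must contain a dot, which leaves the empty set free to encode a new empty row
  at the bottom.\<close>

definition extend_tableau ::
  "(nat \<times> nat \<times> (nat \<times> nat) set \<times> (nat \<times> nat) set) \<times> nat set \<Rightarrow>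
    nat \<times> nat \<times> (nat \<times> nat) set \<times> (nat \<times> nat) set" where
  "extend_tableau = (\<lambda>((r, c, F, D), S).
     if S = {} then (Suc r, c, F, D) else (r, Suc c, add_column {..<r} F, add_column S D))"

text \<open>The bottom row reveals the last step: it is empty after adding a row and nonempty after
  adding a column.\<close>

lemma partial_tableaux_Suc:
  assumes "N \<ge> 1"
  shows "bij_betw extend_tableau
     (SIGMA (r, c, F, D):partial_tableaux N. Pow (live_rows r D)) (partial_tableaux (Suc N))"
    (is "bij_betw _ ?A _")
proof (rule bij_betw_imageI)
  show "inj_on extend_tableau ?A"
  proof -
    have no_eq: False if "F = add_column {..<Suc r} F'" "F \<subseteq> {..<r} \<times> {..<c}" for F F' r c
    proof -
      have "(r, 0) \<in> F"
        by (simp add: that(1))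
      with that(2) show False by auto
    qed
    show ?thesis
    proof (rule inj_onI)
      fix X Y assume "X \<in> ?A" "Y \<in> ?A" and eq: "extend_tableau X = extend_tableau Y"
      then obtain r c F D S r' c' F' D' S' where X: "X = ((r, c, F, D), S)" "F \<subseteq> {..<r} \<times> {..<c}"
        and Y: "Y = ((r', c', F', D'), S')" "F' \<subseteq> {..<r'} \<times> {..<c'}"
        by (auto simp: partial_tableaux_def)
      show "X = Y"
        using eq no_eq [OF _ X(2), of F'] no_eq [OF _ Y(2), of F]
        by (cases "S = {}"; cases "S' = {}") (auto simp: X(1) Y(1) extend_tableau_def)
    qed
  qed
  show "extend_tableau ` ?A = partial_tableaux (Suc N)"
  proof (intro equalityI subsetI)
    fix X assume "X \<in> extend_tableau ` ?A"
    then obtain r c F D S where X: "X = extend_tableau ((r, c, F, D), S)"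
      and *: "0 < r" "r + c = N" "partial_filling r c D" "D \<subseteq> F" "F \<subseteq> {..<r} \<times> {..<c}" "down_closed F"
      and S: "S \<subseteq> live_rows r D"
      by (auto simp: partial_tableaux_def)
    show "X \<in> partial_tableaux (Suc N)"
    proof (cases "S = {}")
      case True
      have "F \<subseteq> {..<Suc r} \<times> {..<c}"
        using *(5) by auto
      moreover have "partial_filling (Suc r) c D"
        using *(3) by (auto simp: partial_filling_def)
      ultimately show ?thesis
        using True * by (simp add: X extend_tableau_def partial_tableaux_def)
    next
      case False
      have "S \<subseteq> {..<r}"
        using S by (auto simp: live_rows_def)
      then show ?thesis
        using False * S by (simp add: X extend_tableau_def partial_tableaux_def
            partial_filling_add_column add_column_mono_iff add_column_subset_rectangle
            down_closed_add_column)
    qed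
  next
    fix X assume "X \<in> partial_tableaux (Suc N)"
    then obtain r k F D where X: "X = (r, k, F, D)"
      and *: "0 < r" "r + k = Suc N" "partial_filling r k D" "D \<subseteq> F" "F \<subseteq> {..<r} \<times> {..<k}" "down_closed F"
      by (auto simp: partial_tableaux_def)
    obtain q where r: "r = Suc q"
      using *(1) gr0_implies_Suc by blast
    show "X \<in> extend_tableau ` ?A"
    proof (cases "(q, 0) \<in> F")
      case True
      then have "k \<noteq> 0"
        using *(5) by auto
      then obtain c where k: "k = Suc c"
        using not0_implies_Suc by blast
      have "(i, 0) \<in> F" if "i < r" for i
        using down_closedD [OF *(6) True] that r by simp
      then obtain F' where F': "F = add_column {..<r} F'" "F' \<subseteq> {..<r} \<times> {..<c}" "down_closed F'"
        using add_full_column_cases *(5,6) k by metis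
      obtain S E where D: "D = add_column S E"
        using add_column_split [of D] by metis
      have E: "partial_filling r c E" "S \<noteq> {}" "S \<subseteq> live_rows r E"
        using *(3) by (auto simp: k D partial_filling_add_column)
      have "(r, c, F', E) \<in> partial_tableaux N"
        using E F' * by (simp add: k D partial_tableaux_def add_column_mono_iff)
      then show ?thesis
        using E by (intro image_eqI [where x = "((r, c, F', E), S)"])
          (auto simp: X k D F'(1) extend_tableau_def)
    next
      case False
      have sub: "F \<subseteq> {..<q} \<times> {..<k}"
      proof (rule subrelI)
        fix i j assume ij: "(i, j) \<in> F"
        then have "i < Suc q" "j < k"
          using *(5) r by auto
        moreover have "i \<noteq> q"
          using False down_closedD [OF *(6) ij, of i 0] by auto
        ultimately show "(i, j) \<in> {..<q} \<times> {..<k}"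
          by simp
      qed
      \<comment> \<open>If the only row were empty, there would be no dots, hence no columns,
        contradicting \<open>r + k = Suc N\<close> with \<open>N \<ge> 1\<close>.\<close>
      have "q \<noteq> 0"
      proof
        assume "q = 0"
        then have "D = {}"
          using sub *(4) by auto
        then have "k = 0"
          using *(3) by (auto simp: partial_filling_def)
        with \<open>q = 0\<close> show False
          using assms *(2) r by simp
      qed
      moreover have "partial_filling q k D"
        using *(3,4) sub by (auto simp: partial_filling_def)
      ultimately have "(q, k, F, D) \<in> partial_tableaux N"
        using * sub r by (simp add: partial_tableaux_def)
      then show ?thesis
        by (intro image_eqI [where x = "((q, k, F, D), {})"])
          (auto simp: X r extend_tableau_def)
    qed
  qed
qed

section \<open>Evaluation of the total weight\<close>

text \<open>Removing a boundary edge moves the weight from \<open>t\<close> to \<open>t + 1\<close>,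
  so the induction ranges over all \<open>t\<close>, and \<open>fact t\<close> absorbs the factor
  \<open>t + 1\<close>. At the base only the empty first row remains, with weight
  \<open>filling_weight l 0 t\<close>.\<close>

lemma sum_partial_tableaux:
  assumes "l \<ge> 1"
  shows "fact t * (\<Sum>(r, c, F, D)\<in>partial_tableaux (Suc N).
           t ^ card (live_rows r D - {0}) * filling_weight l (card (first_row D)) t) =
         fact (t + N) * (t + N) ^ (l - 1)"
proof (induction N arbitrary: t)
  case 0
  then show ?case
    using assms by (simp add: partial_tableaux_1 filling_weight_0 live_rows_def)
next
  case (Suc N)
  define w where "w t = (\<lambda>(r, c :: nat, F :: (nat \<times> nat) set, D).
    t ^ card (live_rows r D - {0}) * filling_weight l (card (first_row D)) t)" for t
  have step: "(\<Sum>S\<in>Pow (live_rows r D). w t (extend_tableau ((r, c, F, D), S))) =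
      (t + 1) * w (t + 1) (r, c, F, D)"
    if "(r, c, F, D) \<in> partial_tableaux (Suc N)" for r c F D
  proof -
    let ?L = "live_rows r D"
    let ?g = "card (?L - {0})"
    define k where "k = card (first_row D)"
    \<comment> \<open>The first row gains a dot exactly if \<open>0 \<in> S\<close>.\<close>
    define u where "u b = filling_weight l (if b then Suc k else k) t" for b
    have r: "0 < r" and D: "partial_filling r c D"
      using that by (auto simp: partial_tableaux_def)
    \<comment> \<open>The added row is empty, hence live, which explains the factor \<open>t\<close>
      for \<open>S = {}\<close>.\<close>
    have "live_rows (Suc r) D = insert r ?L" "r \<notin> ?L"
      using D by (auto simp: partial_filling_def live_rows_def less_Suc_eq)
    then have "card (live_rows (Suc r) D - {0}) = Suc ?g"
      using r by (simp add: insert_Diff_if)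
    then have "w t (extend_tableau ((r, c, F, D), S)) =
        (if S = {} then t * t ^ ?g else t ^ card (insert (Min S) (?L - S) - {0})) * u (0 \<in> S)"
      if "S \<subseteq> ?L" for S
      using that partial_filling_finite [OF D]
      by (simp add: w_def u_def k_def extend_tableau_def live_rows_add_column
          card_first_row_add_column)
    then have "(\<Sum>S\<in>Pow ?L. w t (extend_tableau ((r, c, F, D), S))) =
        (\<Sum>S\<in>Pow ?L. (if S = {} then t * t ^ ?g else t ^ card (insert (Min S) (?L - S) - {0})) * u (0 \<in> S))"
      by (intro sum.cong) auto
    also have "\<dots> = (u True + t * u False) * (t + 1) ^ ?g"
      using r by (intro sum_Pow_live zero_in_live_rows) simp_all
    \<comment> \<open>The recurrence merges the weights for \<open>Suc k\<close> and
      \<open>k\<close> dots at \<open>t\<close> into the weight for \<open>k\<close> dots at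
      \<open>t + 1\<close>, so a weight of the same shape returns.\<close>
    also have "u True + t * u False = (t + 1) * filling_weight l k (t + 1)"
      unfolding u_def using filling_weight_Suc [OF assms] by simp
    finally show ?thesis
      by (simp add: w_def k_def mult_ac del: mult_Suc mult_Suc_right)
  qed
  have "sum (w t) (partial_tableaux (Suc (Suc N))) =
      (\<Sum>x\<in>(SIGMA (r, c, F, D):partial_tableaux (Suc N). Pow (live_rows r D)).
        w t (extend_tableau x))"
    by (rule sum.reindex_bij_betw [symmetric]) (simp add: partial_tableaux_Suc)
  also have "\<dots> = (\<Sum>T\<in>partial_tableaux (Suc N). \<Sum>S\<in>(case T of (r, c, F, D) \<Rightarrow> Pow (live_rows r D)).
      w t (extend_tableau (T, S)))"
    by (subst sum.Sigma) (auto simp: finite_partial_tableaux case_prod_unfold)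
  also have "\<dots> = (\<Sum>T\<in>partial_tableaux (Suc N). (t + 1) * w (t + 1) T)"
    by (intro sum.cong [OF refl]) (use step in \<open>auto simp del: mult_Suc\<close>)
  finally have "fact t * sum (w t) (partial_tableaux (Suc (Suc N))) =
      fact (t + 1) * sum (w (t + 1)) (partial_tableaux (Suc N))"
    by (simp add: sum_distrib_left [symmetric] mult_ac del: mult_Suc)
  also have "\<dots> = fact (t + 1 + N) * (t + 1 + N) ^ (l - 1)"
    using Suc.IH [of "t + 1"] unfolding w_def .
  finally show ?case
    by (simp add: w_def)
qed

theorem proposition2:
  fixes n l :: nat
  assumes "n \<ge> 1" and "l \<ge> 1"
  shows "(\<Sum>k = 1..n. tlt_count n k * nat_count k l) = n ^ (l - 1) * fact n"
proof -
  let ?T = "{(F, D). tree_like_tableau (F, D) \<and> card D = n}"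
  let ?f = "\<lambda>(r, c, F, D). (add_column {..<r} F, add_column (live_rows r D) D)"
  let ?row = "\<lambda>X :: (nat \<times> nat) set \<times> (nat \<times> nat) set. card (first_row (snd X))"
  have fin: "finite ?T"
    by (rule iffD1 [OF bij_betw_finite [OF tree_like_tableaux_bij] finite_partial_tableaux])
  \<comment> \<open>The root lies in the first row, so grouping by \<open>k = 1..n\<close> misses no
    tableau.\<close>
  have "?row X \<in> {1..n}" if "X \<in> ?T" for X
  proof -
    obtain F D where "X = (F, D)"
      by (cases X)
    with that have X: "X = (F, D)" "tree_like_tableau (F, D)" "card D = n"
      by auto
    then have D: "finite D" "(0, 0) \<in> D"
      using assms(1) by (auto simp: tree_like_tableau_def intro: card_ge_0_finite)
    then have "first_row D \<noteq> {}" "card (first_row D) \<le> card D"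
      by (auto intro: card_mono)
    with D show ?thesis
      using X by (simp add: Suc_le_eq card_gt_0_iff)
  qed
  then have range: "?row ` ?T \<subseteq> {1..n}"
    by blast
  have "tlt_count n k = card {X \<in> ?T. ?row X = k}" for k
    unfolding tlt_count_def by (intro arg_cong [where f = card]) auto
  then have "(\<Sum>k = 1..n. tlt_count n k * nat_count k l) =
      (\<Sum>k = 1..n. \<Sum>X\<in>{X \<in> ?T. ?row X = k}. nat_count (?row X) l)"
    by simp
  also have "\<dots> = (\<Sum>X\<in>?T. nat_count (?row X) l)"
    using fin range by (intro sum.group) auto
  also have "\<dots> = (\<Sum>x\<in>partial_tableaux n. nat_count (?row (?f x)) l)"
    by (rule sum.reindex_bij_betw [OF tree_like_tableaux_bij, symmetric])
  also have "\<dots> = (\<Sum>(r, c, F, D)\<in>partial_tableaux n.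
      1 ^ card (live_rows r D - {0}) * filling_weight l (card (first_row D)) 1)"
  \<comment> \<open>Row 0 is live, so the completing column adds one dot to the first row; this
    matches the shift in \<open>nat_count_Suc\<close>.\<close>
  proof (rule sum.cong [OF refl], clarify)
    fix r c F D assume "(r, c, F, D) \<in> partial_tableaux n"
    then have "0 < r" "finite D"
      by (auto simp: partial_tableaux_def partial_filling_finite)
    then show "nat_count (?row (add_column {..<r} F, add_column (live_rows r D) D)) l =
        1 ^ card (live_rows r D - {0}) * filling_weight l (card (first_row D)) 1"
      using assms(2) zero_in_live_rows by (simp add: card_first_row_add_column nat_count_Suc)
  qed
  also have "\<dots> = fact n * n ^ (l - 1)"
    using sum_partial_tableaux [OF assms(2), of 1 "n - 1"] assms(1) by simp
  finally show ?thesis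
    by simp
qed

end
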